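(* Let $\sigma\ge0$. Consider the systems $\dot{x}=-\sigma x+f(t)$ and $\dot{x}=-\sigma x+f_n(t)$, $n\in\mathbb{N}$, where $f,f_n\in L^{\infty}_{\mathrm{loc}}(\mathbb{R})$ are measurable and periodic with period $1$, $f_n(t)-\sigma>0$ a.e. for each $n$, and there is $\varsigma>0$ with $f(t)-\sigma>\varsigma$ a.e. Suppose that all the induced firing maps $\Phi_n$ and $\Phi$ have irrational rotation numbers. Let $\mu^{(n)}_{\mathrm{ISI}}$ and $\mu_{\mathrm{ISI}}$ be the interspike-interval distributions for $\Phi_n$ and $\Phi$ with respect to the corresponding invariant measures $\mu^{(n)}$ and $\mu$. If $f_n\to f$ in the $L^{\infty}_{\mathrm{loc}}(\mathbb{R})$-topology, then $\mu^{(n)}_{\mathrm{ISI}}$ converges weakly to $\mu_{\mathrm{ISI}}$.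
   Context: Periodic with period $1$ means $f(t+1)=f(t)$ for a.e. $t$. The firing map of $\dot{x}=-\sigma x+f(t)$ is $\Phi(t):=\inf\{t_*>t:\ e^{\sigma t}\le\int_t^{t_*}[f(u)-\sigma]e^{\sigma u}\,du\}$. Under the assumptions it is a lift of an orientation preserving circle homeomorphism $\varphi$ (the firing phase map), with rotation number $\varrho=\lim_n\Phi^n(t)/n$. If $\varrho$ is irrational, $\mu$ denotes the unique invariant Borel probability measure of $\varphi$, regarded on $[0,1]$ (with endpoints identified) as an invariant measure of $\Phi\bmod 1$, and the interspike-interval distribution is $\mu_{\mathrm{ISI}}(A):=\mu(\{t\in[0,1]:\Phi(t)-t\in A\})$ for Borel $A\subset\mathbb{R}$; similarly for $\Phi_n$. The topology of $L^\infty_{\mathrm{loc}}(\mathbb{R})$ is that given by the seminorms $\operatorname{ess\,sup}_{[-k,k]}|f|$, $k\in\mathbb{N}$. Weak convergence means convergence of integrals of every bounded continuous function on $\mathbb{R}$. *)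

theory Defs
  imports "HOL-Probability.Probability"
begin

definition ae_periodic1 :: "(real \<Rightarrow> real) \<Rightarrow> bool" where
  "ae_periodic1 f \<longleftrightarrow> (AE t in lebesgue. f (t + 1) = f t)"

text \<open>
  Values are taken in \<^typ>\<open>ennreal\<close> because there the essential supremum over the null
  interval obtained for \<open>k = 0\<close> is \<open>0\<close>; in \<^typ>\<open>ereal\<close> it would be \<open>-\<infinity>\<close>.
\<close>

definition Linf_seminorm :: "nat \<Rightarrow> (real \<Rightarrow> real) \<Rightarrow> ennreal" where
  "Linf_seminorm k f = esssup (restrict_space lebesgue {- real k..real k}) (\<lambda>t. ennreal \<bar>f t\<bar>)"

definition Linf_loc :: "(real \<Rightarrow> real) set" where
  "Linf_loc = {f \<in> borel_measurable lebesgue. \<forall>k. Linf_seminorm k f < \<infinity>}"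

definition tendsto_Linf_loc :: "(nat \<Rightarrow> real \<Rightarrow> real) \<Rightarrow> (real \<Rightarrow> real) \<Rightarrow> bool" where
  "tendsto_Linf_loc fs f \<longleftrightarrow> (\<forall>k. (\<lambda>n. Linf_seminorm k (\<lambda>t. fs n t - f t)) \<longlonglongrightarrow> 0)"

definition firing_map :: "real \<Rightarrow> (real \<Rightarrow> real) \<Rightarrow> real \<Rightarrow> real" where
  "firing_map \<sigma> f t =
     Inf {s. s > t \<and> exp (\<sigma> * t) \<le> (LINT u:{t..s}|lebesgue. (f u - \<sigma>) * exp (\<sigma> * u))}"

definition rotation_number :: "(real \<Rightarrow> real) \<Rightarrow> real" where
  "rotation_number \<Phi> = (THE \<rho>. \<forall>t. (\<lambda>n. (\<Phi> ^^ n) t / real n) \<longlonglongrightarrow> \<rho>)"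

text \<open>
  The circle, i.e. \<open>[0,1]\<close> with endpoints identified, is represented by the fundamental domain
  \<open>[0,1)\<close>; the Borel sets of the circle are then the Borel subsets of \<open>[0,1)\<close>. For a lift
  \<open>\<Phi>\<close>, the induced circle map is \<open>\<Phi> mod 1\<close>.
\<close>

definition phase_map :: "(real \<Rightarrow> real) \<Rightarrow> real \<Rightarrow> real" where
  "phase_map \<Phi> t = frac (\<Phi> t)"

definition invariant_prob :: "(real \<Rightarrow> real) \<Rightarrow> real measure \<Rightarrow> bool" where
  "invariant_prob \<Phi> \<mu> \<longleftrightarrow>
     prob_space \<mu> \<and> sets \<mu> = sets (restrict_space borel {0..<1}) \<and>
     phase_map \<Phi> \<in> measurable \<mu> \<mu> \<and> distr \<mu> \<mu> (phase_map \<Phi>) = \<mu>"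

text \<open>Meaningful when the invariant measure is unique, in particular for irrational rotation number.\<close>

definition invariant_measure :: "(real \<Rightarrow> real) \<Rightarrow> real measure" where
  "invariant_measure \<Phi> = (THE \<mu>. invariant_prob \<Phi> \<mu>)"

text \<open>
  Since \<open>\<Phi> (t + 1) = \<Phi> t + 1\<close> for a lift, the displacement \<open>\<Phi> t - t\<close> is well defined on the
  circle, so nothing depends on which of the identified points \<open>0\<close>, \<open>1\<close> is kept.
\<close>

definition isi_distribution :: "(real \<Rightarrow> real) \<Rightarrow> real measure" where
  "isi_distribution \<Phi> = distr (invariant_measure \<Phi>) borel (\<lambda>t. \<Phi> t - t)"

definition converges_weakly :: "(nat \<Rightarrow> real measure) \<Rightarrow> real measure \<Rightarrow> bool" where
  "converges_weakly \<nu>s \<nu> \<longleftrightarrow>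
     (\<forall>g :: real \<Rightarrow> real. continuous_on UNIV g \<and> bounded (range g) \<longrightarrow>
        (\<lambda>n. LINT x|\<nu>s n. g x) \<longlonglongrightarrow> (LINT x|\<nu>. g x))"

end

theory Submission
  imports Defs "HOL-Analysis.Kronecker_Approximation_Theorem"
begin

text \<open>
  An invariant probability measure \<open>\<mu>\<close> of a circle homeomorphism with lift \<open>\<Phi>\<close> and irrational rotation
  number \<open>\<rho>\<close> has a lifted distribution function \<open>h\<close> with \<open>h 0 = 0\<close>, \<open>h (x + 1) = h x + 1\<close> and
  \<open>h (\<Phi> x) = h x + \<rho>\<close>. These equations prescribe \<open>h\<close> on the orbit points \<open>\<Phi>\<^sup>n 0 + m\<close>, whose images
  \<open>n \<rho> + m\<close> are dense, so \<open>h\<close> is unique and continuous. If lifts \<open>\<Phi>\<^sub>k\<close> converge pointwise to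
  \<open>\<Phi>\<close>, then their orbit points and rotation numbers converge, hence so do the distribution functions.
  Skorohod's theorem and dominated convergence then give weak convergence of the laws of
  \<open>\<Phi>\<^sub>k t - t\<close>. For the firing map, \<open>\<Phi> t \<le> s\<close> holds iff \<open>exp (\<sigma> t) \<le> J t s\<close>, where \<open>J t s\<close> is the
  integral in its definition, so pointwise convergence of \<open>J\<close> gives pointwise convergence of \<open>\<Phi>\<close>.
\<close>

section \<open>Lifts of circle homeomorphisms\<close>

lemma degree_one_int:
  fixes h :: "real \<Rightarrow> real"
  assumes "\<And>x. h (x + 1) = h x + 1"
  shows "h (x + of_int m) = h x + of_int m"
proof (induction m rule: int_induct[where k = 0])
  case (step1 i)
  then show ?case using assms[of "x + of_int i"] by (simp add: add.assoc)
next
  case (step2 i)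
  then show ?case using assms[of "x + of_int i - 1"] by (simp add: algebra_simps)
qed simp

text \<open>By degree one, \<open>h x - x\<close> depends only on \<open>frac x\<close>. On the
  fundamental domain monotonicity confines \<open>h\<close> to an interval of length 1 starting at
  \<open>h 0\<close>, and \<open>frac x\<close> itself lies in [0,1).\<close>

lemma degree_one_deviation:
  fixes h :: "real \<Rightarrow> real"
  assumes deg: "\<And>x. h (x + 1) = h x + 1" and "mono h"
  shows "\<bar>h x - x - h 0\<bar> \<le> 1"
proof -
  have "h x = h (frac x) + of_int \<lfloor>x\<rfloor>"
    using degree_one_int[of h "frac x" "\<lfloor>x\<rfloor>", OF deg] by (simp add: frac_def)
  moreover have "h 0 \<le> h (frac x)" "h (frac x) \<le> h (0 + 1)"
    using \<open>mono h\<close> by (auto intro!: monoD[of h] less_imp_le[OF frac_lt_1])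
  ultimately show ?thesis
    unfolding deg frac_def using floor_correct[of x] by linarith
qed

text \<open>Lift of Poincare's semiconjugacy from the circle map to the rigid rotation.
  \<open>h\<close> may be constant on intervals; the normalisation at 0 removes the freedom of an
  additive constant.\<close>

definition rotation_conjugacy :: "(real \<Rightarrow> real) \<Rightarrow> (real \<Rightarrow> real) \<Rightarrow> bool" where
  "rotation_conjugacy \<Phi> h \<longleftrightarrow> mono h \<and> (\<forall>x. h (x + 1) = h x + 1) \<and>
     (\<forall>x. h (\<Phi> x) = h x + rotation_number \<Phi>) \<and> h 0 = 0"

section \<open>Rotation numbers and the order of orbits\<close>

locale circle_lift =
  fixes \<Phi> :: "real \<Rightarrow> real"
  assumes strict_mono: "strict_mono \<Phi>"
    and cont: "continuous_on UNIV \<Phi>"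
    and degree_one: "\<And>x. \<Phi> (x + 1) = \<Phi> x + 1"
begin

abbreviation \<rho> :: real where "\<rho> \<equiv> rotation_number \<Phi>"

lemma mono_lift: "mono \<Phi>"
  using strict_mono by (rule strict_mono_mono)

lemma iterate_mono: "mono (\<Phi> ^^ n)"
  by (induction n) (auto simp: mono_def intro: monoD[OF mono_lift])

lemma iterate_degree_one: "(\<Phi> ^^ n) (x + 1) = (\<Phi> ^^ n) x + 1"
  by (induction n) (auto simp: degree_one)

lemma iterate_int: "(\<Phi> ^^ n) (x + of_int m) = (\<Phi> ^^ n) x + of_int m"
  by (rule degree_one_int) (rule iterate_degree_one)

lemma iterate_deviation: "\<bar>(\<Phi> ^^ n) x - x - (\<Phi> ^^ n) 0\<bar> \<le> 1"
  by (intro degree_one_deviation iterate_degree_one iterate_mono)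

lemma surj_lift: "surj \<Phi>"
proof -
  have "\<exists>x. \<Phi> x = y" for y
  proof -
    define m where "m = \<lfloor>y - \<Phi> 0\<rfloor>"
    have "\<Phi> (of_int m) = \<Phi> 0 + of_int m"
      using degree_one_int[of \<Phi> 0 m, OF degree_one] by simp
    then have "\<Phi> (of_int m) \<le> y" "y \<le> \<Phi> (of_int m + 1)"
      unfolding m_def degree_one by linarith+
    then show ?thesis
      using IVT'[of \<Phi> "of_int m" y "of_int m + 1"] continuous_on_subset[OF cont] by auto
  qed
  then show ?thesis by (metis surjI)
qed

text \<open>Each further block of \<open>n\<close> iterations adds \<open>(\<Phi> ^^ n) 0\<close> up
  to an error of 1, by \<open>iterate_deviation\<close>; the errors of \<open>m\<close> blocks add
  up.\<close>

lemma iterate_mult_deviation: "\<bar>(\<Phi> ^^ (m * n)) 0 - real m * (\<Phi> ^^ n) 0\<bar> \<le> real m"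
proof (induction m)
  case (Suc m)
  have "(\<Phi> ^^ (Suc m * n)) 0 = (\<Phi> ^^ n) ((\<Phi> ^^ (m * n)) 0)"
    by (simp add: funpow_add)
  then show ?case
    using Suc iterate_deviation[of n "(\<Phi> ^^ (m * n)) 0"] by (simp add: algebra_simps)
qed simp

text \<open>Splitting \<open>m * n\<close> iterations into \<open>m\<close> blocks of length
  \<open>n\<close> or into \<open>n\<close> blocks of length \<open>m\<close> shows that every
  \<open>(a n - 1) / n\<close> lies below every \<open>(a m + 1) / m\<close>. The supremum of the
  former separates the two families.\<close>

lemma translation_number_exists: "\<exists>r. \<forall>n. \<bar>(\<Phi> ^^ n) 0 - real n * r\<bar> \<le> 1"
proof -
  define a where "a = (\<lambda>n. (\<Phi> ^^ n) 0)"
  define S where "S = {(a n - 1) / real n | n. n > 0}"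
  have le: "(a n - 1) / real n \<le> (a m + 1) / real m" if "n > 0" "m > 0" for n m
  proof -
    have "real m * a n - real n * a m \<le> real m + real n"
      using iterate_mult_deviation[of m n] iterate_mult_deviation[of n m]
      by (simp add: a_def mult.commute)
    then show ?thesis using that by (simp add: field_simps)
  qed
  have ub: "Sup S \<le> (a m + 1) / real m" if "m > 0" for m
    by (rule cSup_least) (use that in \<open>auto simp: S_def intro: le\<close>)
  have lb: "(a m - 1) / real m \<le> Sup S" if "m > 0" for m
  proof (rule cSup_upper)
    show "bdd_above S"
      by (rule bdd_aboveI[of _ "(a 1 + 1) / real 1"]) (use le[of _ 1] in \<open>auto simp: S_def\<close>)
  qed (use that in \<open>auto simp: S_def\<close>)
  have "\<bar>a n - real n * Sup S\<bar> \<le> 1" for n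
  proof (cases "n = 0")
    case False
    then show ?thesis using ub[of n] lb[of n] by (simp add: field_simps abs_le_iff)
  qed (simp add: a_def)
  then show ?thesis unfolding a_def by blast
qed

text \<open>Resolves the definite description in \<open>rotation_number\<close>. The bound 2 is 1
  from \<open>translation_number_exists\<close> plus 1 from \<open>iterate_deviation\<close>; its
  uniformity in \<open>n\<close> and \<open>x\<close> is what the later arguments exploit.\<close>

lemma iterate_rotation_bound: "\<bar>(\<Phi> ^^ n) x - x - real n * \<rho>\<bar> \<le> 2"
proof -
  obtain r where r: "\<And>n. \<bar>(\<Phi> ^^ n) 0 - real n * r\<bar> \<le> 1"
    using translation_number_exists by blast
  have bound: "\<bar>(\<Phi> ^^ n) x - x - real n * r\<bar> \<le> 2" for n x
    using r[of n] iterate_deviation[of n x] by linarith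
  have lim: "(\<lambda>n. (\<Phi> ^^ n) t / real n) \<longlonglongrightarrow> r" for t
  proof (rule LIM_zero_cancel, rule Lim_null_comparison)
    show "\<forall>\<^sub>F n in sequentially. norm ((\<Phi> ^^ n) t / real n - r) \<le> (2 + \<bar>t\<bar>) / real n"
      using eventually_gt_at_top[of 0]
    proof eventually_elim
      case (elim n)
      have "(\<Phi> ^^ n) t / real n - r = ((\<Phi> ^^ n) t - real n * r) / real n"
        using elim by (simp add: field_simps)
      moreover have "\<bar>(\<Phi> ^^ n) t - real n * r\<bar> \<le> 2 + \<bar>t\<bar>"
        using bound[of n t] by linarith
      ultimately show ?case
        using elim by (simp add: divide_right_mono)
    qed
    show "(\<lambda>n. (2 + \<bar>t\<bar>) / real n) \<longlonglongrightarrow> 0"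
      by (rule lim_const_over_n)
  qed
  have "\<rho> = r"
    unfolding rotation_number_def
  proof (rule the_equality)
    show "\<forall>t. (\<lambda>n. (\<Phi> ^^ n) t / real n) \<longlonglongrightarrow> r" using lim by blast
  next
    fix s assume "\<forall>t. (\<lambda>n. (\<Phi> ^^ n) t / real n) \<longlonglongrightarrow> s"
    then show "s = r" using lim[of 0] LIMSEQ_unique by blast
  qed
  then show ?thesis using bound by simp
qed

text \<open>Monotonicity and commutation with integer translations allow the inequality to be
  iterated \<open>k\<close> times. If the conclusion failed, the discrepancy would grow linearly in
  \<open>k\<close> and exceed the bound 2 of \<open>iterate_rotation_bound\<close>.\<close>

lemma rotation_le:
  assumes "(\<Phi> ^^ j) y \<le> y + of_int l"
  shows "real j * \<rho> \<le> of_int l"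
proof (rule ccontr)
  assume "\<not> ?thesis"
  then obtain k where k: "2 < real k * (real j * \<rho> - of_int l)"
    using ex_less_of_nat_mult[of "real j * \<rho> - of_int l" 2] by auto
  have "(\<Phi> ^^ (k * j)) y \<le> y + real k * of_int l" for k
  proof (induction k)
    case (Suc k)
    have "(\<Phi> ^^ (Suc k * j)) y = (\<Phi> ^^ j) ((\<Phi> ^^ (k * j)) y)"
      by (simp add: funpow_add)
    also have "\<dots> \<le> (\<Phi> ^^ j) (y + of_int (int k * l))"
      using Suc by (intro monoD[OF iterate_mono]) simp
    also have "\<dots> \<le> y + real (Suc k) * of_int l"
      unfolding iterate_int using assms by (simp add: algebra_simps)
    finally show ?case .
  qed simp
  from this[of k] show False
    using iterate_rotation_bound[of "k * j" y] k by (simp add: algebra_simps abs_le_iff)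
qed

lemma rotation_ge:
  assumes "y + of_int l \<le> (\<Phi> ^^ j) y"
  shows "of_int l \<le> real j * \<rho>"
proof (rule ccontr)
  assume "\<not> ?thesis"
  then obtain k where k: "2 < real k * (of_int l - real j * \<rho>)"
    using ex_less_of_nat_mult[of "of_int l - real j * \<rho>" 2] by auto
  have "y + real k * of_int l \<le> (\<Phi> ^^ (k * j)) y" for k
  proof (induction k)
    case (Suc k)
    have "y + real (Suc k) * of_int l \<le> (\<Phi> ^^ j) (y + of_int (int k * l))"
      unfolding iterate_int using assms by (simp add: algebra_simps)
    also have "\<dots> \<le> (\<Phi> ^^ j) ((\<Phi> ^^ (k * j)) y)"
      using Suc by (intro monoD[OF iterate_mono]) simp
    also have "\<dots> = (\<Phi> ^^ (Suc k * j)) y"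
      by (simp add: funpow_add)
    finally show ?case .
  qed simp
  from this[of k] show False
    using iterate_rotation_bound[of "k * j" y] k by (simp add: algebra_simps abs_le_iff)
qed

text \<open>Only forward iterates occur, so the point with fewer iterations serves as base point and
  the other one is an iterate of it. Depending on which is longer, \<open>rotation_le\<close> or
  \<open>rotation_ge\<close> applies.\<close>

lemma orbit_order:
  assumes "(\<Phi> ^^ n) 0 + of_int m \<le> (\<Phi> ^^ k) 0 + of_int l"
  shows "real n * \<rho> + of_int m \<le> real k * \<rho> + of_int l"
proof (cases "k \<le> n")
  case True
  then have "(\<Phi> ^^ n) 0 = (\<Phi> ^^ (n - k)) ((\<Phi> ^^ k) 0)"
    by (metis comp_apply funpow_add le_add_diff_inverse2)
  then have "real (n - k) * \<rho> \<le> of_int (l - m)"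
    using assms by (intro rotation_le[of _ "(\<Phi> ^^ k) 0"]) simp
  then show ?thesis using True by (simp add: of_nat_diff algebra_simps)
next
  case False
  then have "(\<Phi> ^^ k) 0 = (\<Phi> ^^ (k - n)) ((\<Phi> ^^ n) 0)"
    by (metis comp_apply funpow_add le_add_diff_inverse2 nat_le_linear)
  then have "of_int (m - l) \<le> real (k - n) * \<rho>"
    using assms by (intro rotation_ge[of "(\<Phi> ^^ n) 0"]) simp
  then show ?thesis using False by (simp add: of_nat_diff algebra_simps)
qed

text \<open>The constant \<open>c\<close> is forced to be the rotation number: along the orbit of 0,
  \<open>h\<close> equals \<open>n * c\<close>, deviates from the identity by at most 1, and the
  orbit deviates from \<open>n * \<rho>\<close> by at most 2.\<close>

lemma rotation_conjugacyI:
  assumes "mono h" and deg: "\<And>x. h (x + 1) = h x + 1"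
    and eq: "\<And>x. h (\<Phi> x) = h x + c" and "h 0 = 0"
  shows "rotation_conjugacy \<Phi> h"
proof -
  have it: "h ((\<Phi> ^^ n) 0) = real n * c" for n
    by (induction n) (auto simp: eq \<open>h 0 = 0\<close> algebra_simps)
  have bound: "\<bar>real n * (c - \<rho>)\<bar> \<le> 3" for n
    using degree_one_deviation[of h "(\<Phi> ^^ n) 0", OF deg \<open>mono h\<close>]
      iterate_rotation_bound[of n 0] it[of n] \<open>h 0 = 0\<close> by (simp add: algebra_simps)
  have "c = \<rho>"
  proof (rule ccontr)
    assume "c \<noteq> \<rho>"
    then obtain n where "3 < real n * \<bar>c - \<rho>\<bar>"
      using ex_less_of_nat_mult[of "\<bar>c - \<rho>\<bar>" 3] by auto
    then show False using bound[of n] by (simp add: abs_mult)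
  qed
  then show ?thesis using assms by (simp add: rotation_conjugacy_def)
qed

lemma rotation_conjugacy_orbit:
  assumes "rotation_conjugacy \<Phi> h"
  shows "h ((\<Phi> ^^ n) 0 + of_int m) = real n * \<rho> + of_int m"
proof -
  have h: "\<And>x. h (x + 1) = h x + 1" "\<And>x. h (\<Phi> x) = h x + \<rho>" "h 0 = 0"
    using assms by (auto simp: rotation_conjugacy_def)
  have "h ((\<Phi> ^^ n) 0) = real n * \<rho>"
    by (induction n) (auto simp: h algebra_simps)
  then show ?thesis using degree_one_int[of h, OF h(1)] by simp
qed

text \<open>Values on orbit points are known exactly, so the contrapositive of monotonicity already
  locates \<open>x\<close> strictly on one side of an orbit point.\<close>

lemma rotation_conjugacy_less:
  assumes "rotation_conjugacy \<Phi> h"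
  shows "real n * \<rho> + of_int m < h x \<Longrightarrow> (\<Phi> ^^ n) 0 + of_int m < x"
    and "h x < real n * \<rho> + of_int m \<Longrightarrow> x < (\<Phi> ^^ n) 0 + of_int m"
proof -
  have "mono h" using assms by (simp add: rotation_conjugacy_def)
  note * = rotation_conjugacy_orbit[OF assms, of n m]
  show "real n * \<rho> + of_int m < h x \<Longrightarrow> (\<Phi> ^^ n) 0 + of_int m < x"
    using monoD[OF \<open>mono h\<close>, of x "(\<Phi> ^^ n) 0 + of_int m"] * by linarith
  show "h x < real n * \<rho> + of_int m \<Longrightarrow> x < (\<Phi> ^^ n) 0 + of_int m"
    using monoD[OF \<open>mono h\<close>, of "(\<Phi> ^^ n) 0 + of_int m" x] * by linarith
qed

end

section \<open>The semiconjugacy for irrational rotation number\<close>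

locale irrational_lift = circle_lift +
  assumes irrational: "rotation_number \<Phi> \<notin> \<rat>"
begin

text \<open>Kronecker's theorem approximates the fractional part of the midpoint, and
  \<open>m\<close> corrects the integer parts. Positivity of \<open>n\<close> is recorded so that an
  orbit point can be pulled back once along the forward orbit.\<close>

lemma rotation_dense:
  assumes "a < b"
  obtains n m where "n > 0" "a < real n * \<rho> + of_int m" "real n * \<rho> + of_int m < b"
proof -
  define c where "c = (a + b) / 2"
  have "(b - a) / 2 > 0" using assms by simp
  then obtain k where k: "k > 0" "\<bar>frac (real k * \<rho>) - frac c\<bar> < (b - a) / 2"
    using Kronecker_approx_1_explicit[OF irrational, of "frac c" "(b - a) / 2"]
      frac_ge_0[of c] frac_lt_1[of c] by (metis less_imp_le)
  have "real k * \<rho> + of_int (\<lfloor>c\<rfloor> - \<lfloor>real k * \<rho>\<rfloor>) - c = frac (real k * \<rho>) - frac c"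
    by (simp add: frac_def)
  with k(2) have "\<bar>real k * \<rho> + of_int (\<lfloor>c\<rfloor> - \<lfloor>real k * \<rho>\<rfloor>) - c\<bar> < (b - a) / 2" by simp
  then have "a < real k * \<rho> + of_int (\<lfloor>c\<rfloor> - \<lfloor>real k * \<rho>\<rfloor>)" "real k * \<rho> + of_int (\<lfloor>c\<rfloor> - \<lfloor>real k * \<rho>\<rfloor>) < b"
    unfolding c_def abs_less_iff by (simp_all add: field_simps)
  with k(1) show thesis by (rule that)
qed

text \<open>If two values differed at \<open>x\<close>, some \<open>n * \<rho> + m\<close> would
  separate them, and \<open>x\<close> would lie on both sides of the corresponding orbit
  point.\<close>

lemma rotation_conjugacy_unique:
  assumes "rotation_conjugacy \<Phi> h" "rotation_conjugacy \<Phi> h'"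
  shows "h = h'"
proof -
  have "\<not> h x < h' x" if "rotation_conjugacy \<Phi> h" "rotation_conjugacy \<Phi> h'" for h h' x
  proof
    assume "h x < h' x"
    then obtain n m where "h x < real n * \<rho> + of_int m" "real n * \<rho> + of_int m < h' x"
      by (rule rotation_dense)
    then show False
      using rotation_conjugacy_less(2)[OF that(1)] rotation_conjugacy_less(1)[OF that(2)] by fastforce
  qed
  then show ?thesis using assms by (metis ext linorder_neqE)
qed

text \<open>A monotone function whose values are dense cannot jump; the values on orbit points are
  dense by irrationality.\<close>

lemma rotation_conjugacy_continuous:
  assumes "rotation_conjugacy \<Phi> h"
  shows "isCont h x"
proof -
  have mono: "mono h" using assms by (simp add: rotation_conjugacy_def)
  note orb = rotation_conjugacy_orbit[OF assms]
  show ?thesis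
    unfolding isCont_def
  proof (rule order_tendstoI)
    fix a assume "a < h x"
    then obtain n m where nm: "a < real n * \<rho> + of_int m" "real n * \<rho> + of_int m < h x"
      by (rule rotation_dense)
    have "\<forall>\<^sub>F y in at x. (\<Phi> ^^ n) 0 + of_int m < y"
      using rotation_conjugacy_less(1)[OF assms nm(2)] by (intro order_tendstoD(1)[OF tendsto_ident_at])
    then show "\<forall>\<^sub>F y in at x. a < h y"
    proof eventually_elim
      case (elim y)
      then show ?case using monoD[OF mono, of "(\<Phi> ^^ n) 0 + of_int m" y] orb[of n m] nm by linarith
    qed
  next
    fix a assume "h x < a"
    then obtain n m where nm: "h x < real n * \<rho> + of_int m" "real n * \<rho> + of_int m < a"
      by (rule rotation_dense)
    have "\<forall>\<^sub>F y in at x. y < (\<Phi> ^^ n) 0 + of_int m"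
      using rotation_conjugacy_less(2)[OF assms nm(1)] by (intro order_tendstoD(2)[OF tendsto_ident_at])
    then show "\<forall>\<^sub>F y in at x. h y < a"
    proof eventually_elim
      case (elim y)
      then show ?case using monoD[OF mono, of y "(\<Phi> ^^ n) 0 + of_int m"] orb[of n m] nm by linarith
    qed
  qed
qed

text \<open>Poincare's construction: \<open>h x\<close> is the supremum of the rotation images of
  all orbit points up to \<open>x\<close>, and \<open>orbit_order\<close> makes it consistent. Each
  functional equation follows by contradiction: a separating \<open>n * \<rho> + m\<close> gives an
  orbit point, and shifting it by 1 or pulling it back by \<Phi> puts it on both sides of
  \<open>x\<close>.\<close>

lemma rotation_conjugacy_exists: "\<exists>h. rotation_conjugacy \<Phi> h"
proof -
  define S where "S x = {real n * \<rho> + of_int m | n m. (\<Phi> ^^ n) 0 + of_int m \<le> x}" for x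
  define h where "h x = Sup (S x)" for x
  have ne: "S x \<noteq> {}" for x
  proof -
    have "real 0 * \<rho> + of_int \<lfloor>x\<rfloor> \<in> S x"
      unfolding S_def by (rule CollectI, rule exI[of _ 0], rule exI[of _ "\<lfloor>x\<rfloor>"]) simp
    then show ?thesis by blast
  qed
  have bdd: "bdd_above (S x)" for x
  proof (rule bdd_aboveI)
    fix p assume "p \<in> S x"
    then obtain n m where "p = real n * \<rho> + of_int m" "(\<Phi> ^^ n) 0 + of_int m \<le> x"
      by (auto simp: S_def)
    then show "p \<le> x + 2" using iterate_rotation_bound[of n 0] by (simp add: abs_le_iff)
  qed
  have lower: "real n * \<rho> + of_int m \<le> h x" if "(\<Phi> ^^ n) 0 + of_int m \<le> x" for n m x
    unfolding h_def using that by (intro cSup_upper bdd) (auto simp: S_def)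
  have upper: "h x \<le> real n * \<rho> + of_int m" if "x \<le> (\<Phi> ^^ n) 0 + of_int m" for n m x
    unfolding h_def
  proof (rule cSup_least[OF ne])
    fix p assume "p \<in> S x"
    then obtain k l where "p = real k * \<rho> + of_int l" "(\<Phi> ^^ k) 0 + of_int l \<le> x"
      by (auto simp: S_def)
    then show "p \<le> real n * \<rho> + of_int m" using orbit_order[of k l n m] that by linarith
  qed
  have less: "real n * \<rho> + of_int m < h x \<Longrightarrow> (\<Phi> ^^ n) 0 + of_int m < x"
    and greater: "h x < real n * \<rho> + of_int m \<Longrightarrow> x < (\<Phi> ^^ n) 0 + of_int m" for n m x
    using lower[of n m x] upper[of x n m] by linarith+
  have "mono h"
  proof (rule monoI, rule ccontr)
    fix x y :: real assume "x \<le> y" "\<not> h x \<le> h y"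
    then obtain n m where "h y < real n * \<rho> + of_int m" "real n * \<rho> + of_int m < h x"
      using rotation_dense[of "h y" "h x"] by (metis not_le)
    then show False using less greater \<open>x \<le> y\<close> by fastforce
  qed
  moreover have "h (x + 1) = h x + 1" for x
  proof (rule linorder_cases[of "h (x + 1)" "h x + 1"])
    assume "h (x + 1) < h x + 1"
    then obtain n m where "h (x + 1) < real n * \<rho> + of_int m" "real n * \<rho> + of_int m < h x + 1"
      using rotation_dense by blast
    then show ?thesis using greater[of "x + 1" n m] less[of n "m - 1" x] by simp
  next
    assume "h x + 1 < h (x + 1)"
    then obtain n m where "h x + 1 < real n * \<rho> + of_int m" "real n * \<rho> + of_int m < h (x + 1)"
      using rotation_dense by blast
    then show ?thesis using less[of n m "x + 1"] greater[of x n "m - 1"] by simp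
  qed simp
  moreover have "h (\<Phi> x) = h x + \<rho>" for x
  proof -
    \<comment> \<open>For \<open>n > 0\<close> the orbit point has a preimage under \<Phi> that is
      again of the form used in \<open>S\<close>.\<close>
    have step: "\<exists>k. n = Suc k \<and> (\<Phi> ^^ n) 0 + of_int m = \<Phi> ((\<Phi> ^^ k) 0 + of_int m)" if "n > 0" for n m
      using that degree_one_int[of \<Phi>, OF degree_one] by (cases n) auto
    show ?thesis
    proof (rule linorder_cases[of "h (\<Phi> x)" "h x + \<rho>"])
      assume "h (\<Phi> x) < h x + \<rho>"
      then obtain n m where nm: "n > 0" "h (\<Phi> x) < real n * \<rho> + of_int m" "real n * \<rho> + of_int m < h x + \<rho>"
        by (rule rotation_dense)
      obtain k where k: "n = Suc k" "(\<Phi> ^^ n) 0 + of_int m = \<Phi> ((\<Phi> ^^ k) 0 + of_int m)"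
        using step[OF nm(1)] by blast
      have "x < (\<Phi> ^^ k) 0 + of_int m"
        using greater[OF nm(2)] strict_mono_less[OF strict_mono] unfolding k(2) by blast
      moreover have "(\<Phi> ^^ k) 0 + of_int m < x"
        using nm(3) k(1) by (intro less) (simp add: algebra_simps)
      ultimately show ?thesis by simp
    next
      assume "h x + \<rho> < h (\<Phi> x)"
      then obtain n m where nm: "n > 0" "h x + \<rho> < real n * \<rho> + of_int m" "real n * \<rho> + of_int m < h (\<Phi> x)"
        by (rule rotation_dense)
      obtain k where k: "n = Suc k" "(\<Phi> ^^ n) 0 + of_int m = \<Phi> ((\<Phi> ^^ k) 0 + of_int m)"
        using step[OF nm(1)] by blast
      have "(\<Phi> ^^ k) 0 + of_int m < x"
        using less[OF nm(3)] strict_mono_less[OF strict_mono] unfolding k(2) by blast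
      moreover have "x < (\<Phi> ^^ k) 0 + of_int m"
        using nm(2) k(1) by (intro greater) (simp add: algebra_simps)
      ultimately show ?thesis by simp
    qed simp
  qed
  moreover have "h 0 = 0"
    using lower[of 0 0 0] upper[of 0 0 0] by simp
  ultimately show ?thesis by (auto simp: rotation_conjugacy_def)
qed

end

section \<open>Stability under pointwise convergence of lifts\<close>

text \<open>Monotonicity squeezes \<open>Fs n (ys n)\<close> between the values at the two fixed
  points \<open>y - d/2\<close> and \<open>y + d/2\<close>, where pointwise convergence suffices.
  This replaces locally uniform convergence.\<close>

lemma mono_tendsto_continuous_convergence:
  fixes F :: "real \<Rightarrow> real" and Fs :: "nat \<Rightarrow> real \<Rightarrow> real"
  assumes mono: "\<And>n. mono (Fs n)" and lim: "\<And>t. (\<lambda>n. Fs n t) \<longlonglongrightarrow> F t"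
    and "isCont F y" and ys: "ys \<longlonglongrightarrow> y"
  shows "(\<lambda>n. Fs n (ys n)) \<longlonglongrightarrow> F y"
proof (rule tendstoI)
  fix e :: real assume "e > 0"
  then obtain d where "d > 0" and d: "\<And>z. dist z y < d \<Longrightarrow> dist (F z) (F y) < e / 2"
    using \<open>isCont F y\<close> unfolding continuous_at_eps_delta by (metis half_gt_zero dist_real_def)
  have ab: "dist (F (y - d/2)) (F y) < e / 2" "dist (F (y + d/2)) (F y) < e / 2"
    using \<open>d > 0\<close> by (intro d; simp add: dist_real_def)+
  have "\<forall>\<^sub>F n in sequentially. dist (Fs n (y - d/2)) (F (y - d/2)) < e / 2"
    "\<forall>\<^sub>F n in sequentially. dist (Fs n (y + d/2)) (F (y + d/2)) < e / 2"
    "\<forall>\<^sub>F n in sequentially. dist (ys n) y < d / 2"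
    by (intro tendstoD[OF lim] tendstoD[OF ys] half_gt_zero; fact)+
  then show "\<forall>\<^sub>F n in sequentially. dist (Fs n (ys n)) (F y) < e"
  proof eventually_elim
    case (elim n)
    have "y - d/2 \<le> ys n" "ys n \<le> y + d/2"
      using elim(3) unfolding dist_real_def abs_less_iff by linarith+
    then have "Fs n (y - d/2) \<le> Fs n (ys n)" "Fs n (ys n) \<le> Fs n (y + d/2)"
      using monoD[OF mono] by blast+
    then show ?case using elim(1,2) ab unfolding dist_real_def by arith
  qed
qed

lemma iterate_tendsto:
  assumes "irrational_lift \<Phi>" and "\<And>n. irrational_lift (\<Phi>s n)"
    and lim: "\<And>t. (\<lambda>n. \<Phi>s n t) \<longlonglongrightarrow> \<Phi> t"
  shows "(\<lambda>n. (\<Phi>s n ^^ N) x) \<longlonglongrightarrow> (\<Phi> ^^ N) x"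
proof (induction N)
  case (Suc N)
  interpret irrational_lift \<Phi> by fact
  have "mono (\<Phi>s n)" for n
  proof -
    interpret s: irrational_lift "\<Phi>s n" by fact
    show ?thesis by (rule s.mono_lift)
  qed
  moreover have "isCont \<Phi> ((\<Phi> ^^ N) x)"
    using cont by (simp add: continuous_on_eq_continuous_at)
  ultimately show ?case
    using mono_tendsto_continuous_convergence[of \<Phi>s \<Phi>, OF _ lim _ Suc] by simp
qed simp

lemma rotation_number_tendsto:
  assumes "irrational_lift \<Phi>" and irr: "\<And>n. irrational_lift (\<Phi>s n)"
    and lim: "\<And>t. (\<lambda>n. \<Phi>s n t) \<longlonglongrightarrow> \<Phi> t"
  shows "(\<lambda>n. rotation_number (\<Phi>s n)) \<longlonglongrightarrow> rotation_number \<Phi>"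
proof (rule tendstoI)
  fix e :: real assume "e > 0"
  interpret irrational_lift \<Phi> by fact
  \<comment> \<open>The 5 collects an error of 2 from \<open>iterate_rotation_bound\<close> for each
    of the two lifts and 1 for the distance of their \<open>N\<close>-th iterates.\<close>
  obtain N where N: "5 < real N * e"
    using ex_less_of_nat_mult[OF \<open>e > 0\<close>] by blast
  have "\<forall>\<^sub>F n in sequentially. dist ((\<Phi>s n ^^ N) 0) ((\<Phi> ^^ N) 0) < 1"
    by (intro tendstoD[OF iterate_tendsto[OF assms]]) simp
  then show "\<forall>\<^sub>F n in sequentially. dist (rotation_number (\<Phi>s n)) \<rho> < e"
  proof eventually_elim
    case (elim n)
    interpret s: irrational_lift "\<Phi>s n" by fact
    have "\<bar>real N * rotation_number (\<Phi>s n) - real N * \<rho>\<bar> < 5"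
      using elim iterate_rotation_bound[of N 0] s.iterate_rotation_bound[of N 0]
      unfolding dist_real_def by linarith
    then have "real N * \<bar>rotation_number (\<Phi>s n) - \<rho>\<bar> < real N * e"
      using N by (simp flip: right_diff_distrib add: abs_mult)
    then show ?case by (simp add: dist_real_def mult_less_cancel_left)
  qed
qed

text \<open>Choose an orbit image strictly between \<open>a\<close> and \<open>h x\<close>. Its
  orbit point is then strictly on one side of \<open>x\<close>; both strict inequalities survive for
  large \<open>n\<close>, since orbit points and their images converge.\<close>

lemma rotation_conjugacy_tendsto:
  assumes "irrational_lift \<Phi>" and irr: "\<And>n. irrational_lift (\<Phi>s n)"
    and lim: "\<And>t. (\<lambda>n. \<Phi>s n t) \<longlonglongrightarrow> \<Phi> t"
    and h: "rotation_conjugacy \<Phi> h" and hs: "\<And>n. rotation_conjugacy (\<Phi>s n) (hs n)"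
  shows "(\<lambda>n. hs n x) \<longlonglongrightarrow> h x"
proof -
  interpret irrational_lift \<Phi> by fact
  have orbit: "(\<lambda>n. (\<Phi>s n ^^ k) 0 + of_int m) \<longlonglongrightarrow> (\<Phi> ^^ k) 0 + of_int m" for k m
    by (intro tendsto_intros iterate_tendsto[OF assms(1-3)])
  have rot: "(\<lambda>n. real k * rotation_number (\<Phi>s n) + of_int m) \<longlonglongrightarrow> real k * \<rho> + of_int m" for k m
    by (intro tendsto_intros rotation_number_tendsto[OF assms(1-3)])
  show ?thesis
  proof (rule order_tendstoI)
    fix a assume "a < h x"
    then obtain k m where km: "a < real k * \<rho> + of_int m" "real k * \<rho> + of_int m < h x"
      by (rule rotation_dense)
    from order_tendstoD(1)[OF rot km(1)]
      order_tendstoD(2)[OF orbit rotation_conjugacy_less(1)[OF h km(2)]]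
    show "\<forall>\<^sub>F n in sequentially. a < hs n x"
    proof eventually_elim
      case (elim n)
      interpret s: irrational_lift "\<Phi>s n" by fact
      show ?case using s.rotation_conjugacy_less(2)[OF hs, of x k m] elim by linarith
    qed
  next
    fix a assume "h x < a"
    then obtain k m where km: "h x < real k * \<rho> + of_int m" "real k * \<rho> + of_int m < a"
      by (rule rotation_dense)
    from order_tendstoD(2)[OF rot km(2)]
      order_tendstoD(1)[OF orbit rotation_conjugacy_less(2)[OF h km(1)]]
    show "\<forall>\<^sub>F n in sequentially. hs n x < a"
    proof eventually_elim
      case (elim n)
      interpret s: irrational_lift "\<Phi>s n" by fact
      show ?case using s.rotation_conjugacy_less(1)[OF hs, of k m x] elim by linarith
    qed
  qed
qed

section \<open>Invariant measures and interspike-interval distributions\<close>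

text \<open>The integrand is \<open>1\<close>-periodic in \<open>t\<close>, and for \<open>t\<close> in \<open>[0,1)\<close>, \<open>x\<close> in \<open>[0,1]\<close> it is the indicator of \<open>t < x\<close>.\<close>

definition lifted_cdf :: "real measure \<Rightarrow> real \<Rightarrow> real" where
  "lifted_cdf \<mu> x = (LINT t|\<mu>. of_int (\<lfloor>t\<rfloor> - \<lfloor>t - x\<rfloor>))"

section \<open>Probability measures on the circle and their distribution functions\<close>

locale circle_prob = prob_space \<mu> for \<mu> :: "real measure" +
  assumes sets_circle: "sets \<mu> = sets (restrict_space borel {0..<1})"
begin

lemma space_circle: "space \<mu> = {0..<1}"
  using sets_eq_imp_space_eq[OF sets_circle] by (simp add: space_restrict_space)

lemma borel_measurable_circle: "f \<in> borel_measurable borel \<Longrightarrow> f \<in> borel_measurable \<mu>"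
  by (simp add: measurable_cong_sets[OF sets_circle refl] measurable_restrict_space1)

lemma measurable_circle_circle:
  assumes "f \<in> borel_measurable borel" "\<And>x. f x \<in> {0..<1}"
  shows "f \<in> measurable \<mu> \<mu>"
proof -
  have "f \<in> measurable \<mu> (restrict_space borel {0..<1})"
    using assms by (intro measurable_restrict_space2 borel_measurable_circle) auto
  then show ?thesis by (simp add: measurable_cong_sets[OF refl sets_circle])
qed

lemma integrable_floor_diff: "integrable \<mu> (\<lambda>t. real_of_int (\<lfloor>t\<rfloor> - \<lfloor>t - x\<rfloor>))"
proof (rule integrable_const_bound)
  show "AE t in \<mu>. norm (real_of_int (\<lfloor>t\<rfloor> - \<lfloor>t - x\<rfloor>)) \<le> \<bar>x\<bar> + 1"
    by (rule AE_I2) (simp add: abs_if; linarith)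
  show "(\<lambda>t. real_of_int (\<lfloor>t\<rfloor> - \<lfloor>t - x\<rfloor>)) \<in> borel_measurable \<mu>"
    by (rule borel_measurable_circle) measurable
qed

lemma mono_lifted_cdf: "mono (lifted_cdf \<mu>)"
  unfolding lifted_cdf_def
  by (intro monoI integral_mono integrable_floor_diff) (simp add: floor_mono)

lemma lifted_cdf_degree_one: "lifted_cdf \<mu> (x + 1) = lifted_cdf \<mu> x + 1"
proof -
  have "lifted_cdf \<mu> (x + 1) = (LINT t|\<mu>. of_int (\<lfloor>t\<rfloor> - \<lfloor>t - x\<rfloor>) + 1)"
    unfolding lifted_cdf_def
  proof (rule Bochner_Integration.integral_cong[OF refl])
    fix t
    have "t - (x + 1) = (t - x) - 1" by simp
    then show "real_of_int (\<lfloor>t\<rfloor> - \<lfloor>t - (x + 1)\<rfloor>) = of_int (\<lfloor>t\<rfloor> - \<lfloor>t - x\<rfloor>) + 1"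
      by (simp only: floor_diff_one of_int_diff of_int_1)
  qed
  then show ?thesis
    using integrable_floor_diff by (simp add: lifted_cdf_def prob_space)
qed

lemma lifted_cdf_zero: "lifted_cdf \<mu> 0 = 0"
  by (simp add: lifted_cdf_def)

lemma lifted_cdf_eq_prob:
  assumes "0 \<le> x" "x \<le> 1"
  shows "lifted_cdf \<mu> x = prob {0..<x}"
proof -
  have "lifted_cdf \<mu> x = (LINT t|\<mu>. indicator {0..<x} t)"
    unfolding lifted_cdf_def
  proof (rule Bochner_Integration.integral_cong[OF refl])
    fix t assume "t \<in> space \<mu>"
    then have t: "0 \<le> t" "t < 1" by (auto simp: space_circle)
    then have "\<lfloor>t\<rfloor> = 0" by (simp add: floor_eq_iff)
    moreover have "\<lfloor>t - x\<rfloor> = (if t < x then -1 else 0)"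
      using t assms by (auto simp: floor_eq_iff)
    ultimately show "real_of_int (\<lfloor>t\<rfloor> - \<lfloor>t - x\<rfloor>) = indicator {0..<x} t"
      using t by (auto simp: indicator_def)
  qed
  also have "\<dots> = prob ({0..<x} \<inter> space \<mu>)"
    by simp
  also have "{0..<x} \<inter> space \<mu> = {0..<x}"
    using assms by (auto simp: space_circle)
  finally show ?thesis .
qed

lemma real_distribution_circle: "real_distribution (distr \<mu> borel (\<lambda>t. t))"
  by (intro real_distribution_distr) (simp add: borel_measurable_circle)

lemma measure_lessThan_circle:
  "measure (distr \<mu> borel (\<lambda>t. t)) {..<x} = lifted_cdf \<mu> (max 0 (min 1 x))"
proof -
  have "measure (distr \<mu> borel (\<lambda>t. t)) {..<x} = prob ({..<x} \<inter> space \<mu>)"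
    by (subst measure_distr) (auto simp: borel_measurable_circle vimage_def)
  also have "{..<x} \<inter> space \<mu> = {0..<max 0 (min 1 x)}"
    by (auto simp: space_circle)
  finally show ?thesis by (simp add: lifted_cdf_eq_prob)
qed

text \<open>\<open>cdf\<close> counts the mass up to and including \<open>x\<close>,
  \<open>lifted_cdf\<close> only the mass strictly below. The gap closes by letting \<open>y\<close>
  decrease to \<open>x\<close>, using continuity. The clamping to [0,1] reflects that all mass lies
  in [0,1).\<close>

lemma cdf_circle:
  assumes "\<And>x. isCont (lifted_cdf \<mu>) x"
  shows "cdf (distr \<mu> borel (\<lambda>t. t)) x = lifted_cdf \<mu> (max 0 (min 1 x))"
proof -
  interpret R: real_distribution "distr \<mu> borel (\<lambda>t. t)" by (rule real_distribution_circle)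
  let ?F = "\<lambda>y. lifted_cdf \<mu> (max 0 (min 1 y))"
  have "isCont (\<lambda>y::real. max 0 (min 1 y)) x"
    by (intro continuous_intros)
  then have "isCont ?F x"
    by (rule isCont_o2) (rule assms)
  then have lim: "(?F \<longlongrightarrow> ?F x) (at_right x)"
    unfolding isCont_def by (rule filterlim_mono) (auto simp: at_le)
  have "cdf (distr \<mu> borel (\<lambda>t. t)) x \<le> ?F x"
  proof (rule tendsto_lowerbound[OF lim])
    show "\<forall>\<^sub>F y in at_right x. cdf (distr \<mu> borel (\<lambda>t. t)) x \<le> ?F y"
      using eventually_at_right_less
    proof eventually_elim
      case (elim y)
      then show ?case
        unfolding cdf_def measure_lessThan_circle[symmetric]
        by (intro R.finite_measure_mono) auto
    qed
  qed simp
  moreover have "?F x \<le> cdf (distr \<mu> borel (\<lambda>t. t)) x"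
    unfolding cdf_def measure_lessThan_circle[symmetric]
    by (intro R.finite_measure_mono) auto
  ultimately show ?thesis by simp
qed

end

text \<open>Both measures are pushed to the real line, where the \<open>cdf\<close> determines a
  distribution; nothing is lost because the measurable sets are the Borel subsets of [0,1).\<close>

lemma circle_prob_eqI:
  assumes "circle_prob \<mu>" "circle_prob \<mu>'"
    and eq: "lifted_cdf \<mu> = lifted_cdf \<mu>'" and cont: "\<And>x. isCont (lifted_cdf \<mu>) x"
  shows "\<mu> = \<mu>'"
proof -
  interpret M: circle_prob \<mu> by fact
  interpret N: circle_prob \<mu>' by fact
  have "cdf (distr \<mu> borel (\<lambda>t. t)) = cdf (distr \<mu>' borel (\<lambda>t. t))"
    using M.cdf_circle N.cdf_circle cont eq by auto
  then have distr: "distr \<mu> borel (\<lambda>t. t) = distr \<mu>' borel (\<lambda>t. t)"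
    by (intro cdf_unique M.real_distribution_circle N.real_distribution_circle)
  show ?thesis
  proof (rule measure_eqI)
    show "sets \<mu> = sets \<mu>'" by (simp add: M.sets_circle N.sets_circle)
    fix A assume "A \<in> sets \<mu>"
    then have A: "A \<in> sets borel" "A \<subseteq> {0..<1}"
      by (auto simp: M.sets_circle sets_restrict_space)
    have "emeasure \<mu> A = emeasure (distr \<mu> borel (\<lambda>t. t)) A"
      using A by (subst emeasure_distr)
        (auto simp: M.borel_measurable_circle M.space_circle Int_absorb2)
    also have "\<dots> = emeasure \<mu>' A"
      unfolding distr using A by (subst emeasure_distr)
        (auto simp: N.borel_measurable_circle N.space_circle Int_absorb2)
    finally show "emeasure \<mu> A = emeasure \<mu>' A" .
  qed
qed

text \<open>The Stieltjes measure of \<open>h\<close>, frozen outside [0,1] and restricted to [0,1).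
  Continuity excludes atoms, so half-open intervals have the expected mass; degree one extends the
  identity from [0,1] to the line.\<close>

lemma circle_prob_exists:
  fixes h :: "real \<Rightarrow> real"
  assumes "mono h" and deg: "\<And>x. h (x + 1) = h x + 1"
    and "h 0 = 0" and cont: "\<And>x. isCont h x"
  shows "\<exists>\<mu>. circle_prob \<mu> \<and> lifted_cdf \<mu> = h"
proof -
  define F where "F x = h (max 0 (min 1 x))" for x
  define \<nu> where "\<nu> = interval_measure F"
  define \<mu> where "\<mu> = restrict_space \<nu> {0..<1}"
  have h1: "h 1 = 1" using deg[of 0] \<open>h 0 = 0\<close> by simp
  have mono: "F x \<le> F y" if "x \<le> y" for x y
    unfolding F_def using that by (intro monoD[OF \<open>mono h\<close>]) auto
  have "isCont (\<lambda>y::real. max 0 (min 1 y)) x" for x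
    by (intro continuous_intros)
  then have Fcont: "continuous_on UNIV F"
    unfolding F_def by (auto simp: continuous_on_eq_continuous_at intro!: isCont_o2[OF _ cont])
  have sets_\<nu>: "sets \<nu> = sets borel" by (simp add: \<nu>_def)
  have Icc: "emeasure \<nu> {a..b} = F b - F a" if "a \<le> b" for a b
    unfolding \<nu>_def by (rule emeasure_interval_measure_Icc[OF that mono Fcont])
  have Ico: "emeasure \<nu> {0..<x} = ennreal (h x)" if "0 \<le> x" "x \<le> 1" for x
  proof -
    have "{0..<x} = {0..x} - {x..x}" by auto
    then have "emeasure \<nu> {0..<x} = emeasure \<nu> {0..x} - emeasure \<nu> {x..x}"
      by (simp only:) (rule emeasure_Diff, auto simp: sets_\<nu> that Icc simp del: atLeastAtMost_singleton_iff atLeastAtMost_singleton)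
    also have "\<dots> = ennreal (h x)"
      using that Icc[of 0 x] Icc[of x x] \<open>h 0 = 0\<close> by (simp add: F_def del: atLeastAtMost_singleton)
    finally show ?thesis .
  qed
  have emu: "emeasure \<mu> {0..<x} = ennreal (h x)" if "0 \<le> x" "x \<le> 1" for x
    unfolding \<mu>_def using that
    by (subst emeasure_restrict_space) (auto simp: sets_\<nu> Ico)
  have sets_\<mu>: "sets \<mu> = sets (restrict_space borel {0..<1})"
    unfolding \<mu>_def by (rule sets_restrict_space_cong[OF sets_\<nu>])
  have "prob_space \<mu>"
  proof (rule prob_spaceI)
    have "space \<mu> = {0..<1}"
      using sets_eq_imp_space_eq[OF sets_\<mu>] by (simp add: space_restrict_space)
    then show "emeasure \<mu> (space \<mu>) = 1"
      using emu[of 1] h1 by simp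
  qed
  then interpret circle_prob \<mu>
    unfolding circle_prob_def circle_prob_axioms_def using sets_\<mu> by blast
  have unit: "lifted_cdf \<mu> x = h x" if "0 \<le> x" "x \<le> 1" for x
  proof -
    have "0 \<le> h x" using monoD[OF \<open>mono h\<close> that(1)] \<open>h 0 = 0\<close> by simp
    then show ?thesis
      using emu[OF that] lifted_cdf_eq_prob[OF that] by (simp add: measure_def)
  qed
  have "lifted_cdf \<mu> x = h x" for x
  proof -
    have "x = frac x + of_int \<lfloor>x\<rfloor>" by (simp add: frac_def)
    moreover have "lifted_cdf \<mu> (frac x + of_int \<lfloor>x\<rfloor>) = h (frac x + of_int \<lfloor>x\<rfloor>)"
      using unit[of "frac x"] frac_lt_1[of x]
      by (simp add: degree_one_int[of h, OF deg] degree_one_int[of "lifted_cdf \<mu>", OF lifted_cdf_degree_one])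
    ultimately show ?thesis by simp
  qed
  then show ?thesis using circle_prob_axioms by blast
qed

section \<open>Invariant measures correspond to semiconjugacies\<close>

context circle_lift
begin

lemma borel_measurable_lift: "\<Phi> \<in> borel_measurable borel"
  by (rule borel_measurable_continuous_onI) (rule cont)

lemma borel_measurable_phase_map: "phase_map \<Phi> \<in> borel_measurable borel"
  unfolding phase_map_def frac_def using borel_measurable_lift by measurable

lemma measurable_phase_map: "circle_prob \<mu> \<Longrightarrow> phase_map \<Phi> \<in> measurable \<mu> \<mu>"
  by (rule circle_prob.measurable_circle_circle[OF _ borel_measurable_phase_map])
    (auto simp: phase_map_def frac_lt_1)

lemma circle_prob_distr:
  assumes "circle_prob \<mu>"
  shows "circle_prob (distr \<mu> \<mu> (phase_map \<Phi>))"
proof -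
  interpret circle_prob \<mu> by fact
  show ?thesis
    unfolding circle_prob_def circle_prob_axioms_def
    using prob_space_distr[OF measurable_phase_map[OF assms]] sets_circle by simp
qed

text \<open>\<Phi> preserves order and commutes with integer translations, so it preserves the
  position of \<open>t\<close> relative to the translates \<open>y + m\<close>. This is why
  \<open>lifted_cdf\<close> is expressed through floors.\<close>

lemma floor_lift_diff: "\<lfloor>\<Phi> t - \<Phi> y\<rfloor> = \<lfloor>t - y\<rfloor>"
proof (rule floor_unique)
  have *: "\<Phi> (y + of_int m) = \<Phi> y + of_int m" for m
    by (rule degree_one_int) (rule degree_one)
  have "\<Phi> (y + of_int \<lfloor>t - y\<rfloor>) \<le> \<Phi> t"
    by (intro monoD[OF mono_lift]) linarith
  then show "of_int \<lfloor>t - y\<rfloor> \<le> \<Phi> t - \<Phi> y" unfolding * by simp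
  have "\<Phi> t < \<Phi> (y + of_int (\<lfloor>t - y\<rfloor> + 1))"
    by (intro strict_monoD[OF strict_mono]) linarith
  then show "\<Phi> t - \<Phi> y < of_int \<lfloor>t - y\<rfloor> + 1" unfolding * by simp
qed

text \<open>The push-forward changes the integrand \<open>\<lfloor>t\<rfloor> - \<lfloor>t - y\<rfloor>\<close> only by \<open>\<lfloor>\<Phi> t\<rfloor> - \<lfloor>t\<rfloor>\<close>, which does not depend on \<open>y\<close>.\<close>

lemma lifted_cdf_distr:
  assumes "circle_prob \<mu>"
  shows "\<exists>c. \<forall>y. lifted_cdf (distr \<mu> \<mu> (phase_map \<Phi>)) (\<Phi> y) = lifted_cdf \<mu> y + c"
proof (intro exI allI)
  fix y
  interpret circle_prob \<mu> by fact
  let ?d = "\<lambda>t. real_of_int (\<lfloor>\<Phi> t\<rfloor> - \<lfloor>t\<rfloor>)"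
  have int: "integrable \<mu> ?d"
  proof (rule integrable_const_bound)
    \<comment> \<open>One unit comes from \<open>degree_one_deviation\<close>, the other from
      rounding by the two floors.\<close>
    show "AE t in \<mu>. norm (?d t) \<le> \<bar>\<Phi> 0\<bar> + 2"
    proof (rule AE_I2)
      fix t show "norm (?d t) \<le> \<bar>\<Phi> 0\<bar> + 2"
        using degree_one_deviation[of \<Phi> t, OF degree_one mono_lift] by (simp add: abs_if; linarith)
    qed
    show "?d \<in> borel_measurable \<mu>"
      using borel_measurable_lift by (intro borel_measurable_circle) measurable
  qed
  have "lifted_cdf (distr \<mu> \<mu> (phase_map \<Phi>)) (\<Phi> y) =
      (LINT t|\<mu>. of_int (\<lfloor>phase_map \<Phi> t\<rfloor> - \<lfloor>phase_map \<Phi> t - \<Phi> y\<rfloor>))"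
    unfolding lifted_cdf_def
    by (rule integral_distr[OF measurable_phase_map[OF assms]])
      (rule borel_measurable_circle, measurable)
  also have "\<dots> = (LINT t|\<mu>. of_int (\<lfloor>t\<rfloor> - \<lfloor>t - y\<rfloor>) + ?d t)"
  proof (rule Bochner_Integration.integral_cong[OF refl])
    fix t
    have "phase_map \<Phi> t - \<Phi> y = (\<Phi> t - \<Phi> y) - of_int \<lfloor>\<Phi> t\<rfloor>"
      by (simp add: phase_map_def frac_def)
    then have "\<lfloor>phase_map \<Phi> t - \<Phi> y\<rfloor> = \<lfloor>t - y\<rfloor> - \<lfloor>\<Phi> t\<rfloor>"
      by (simp only: floor_diff_of_int floor_lift_diff)
    then show "real_of_int (\<lfloor>phase_map \<Phi> t\<rfloor> - \<lfloor>phase_map \<Phi> t - \<Phi> y\<rfloor>) =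
        of_int (\<lfloor>t\<rfloor> - \<lfloor>t - y\<rfloor>) + ?d t"
      by (simp add: phase_map_def)
  qed
  also have "\<dots> = lifted_cdf \<mu> y + (LINT t|\<mu>. ?d t)"
    unfolding lifted_cdf_def by (rule Bochner_Integration.integral_add[OF integrable_floor_diff int])
  finally show "lifted_cdf (distr \<mu> \<mu> (phase_map \<Phi>)) (\<Phi> y) = lifted_cdf \<mu> y + (LINT t|\<mu>. ?d t)" .
qed

lemma invariant_prob_iff:
  "invariant_prob \<Phi> \<mu> \<longleftrightarrow> circle_prob \<mu> \<and> distr \<mu> \<mu> (phase_map \<Phi>) = \<mu>"
  using measurable_phase_map[of \<mu>]
  by (auto simp: invariant_prob_def circle_prob_def circle_prob_axioms_def)

lemma rotation_conjugacy_lifted_cdf: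
  assumes "invariant_prob \<Phi> \<mu>"
  shows "rotation_conjugacy \<Phi> (lifted_cdf \<mu>)"
proof -
  have \<mu>: "circle_prob \<mu>" "distr \<mu> \<mu> (phase_map \<Phi>) = \<mu>"
    using assms by (auto simp: invariant_prob_iff)
  interpret circle_prob \<mu> by fact
  obtain c where "\<And>y. lifted_cdf \<mu> (\<Phi> y) = lifted_cdf \<mu> y + c"
    using lifted_cdf_distr[OF \<mu>(1)] \<mu>(2) by auto
  then show ?thesis
    by (intro rotation_conjugacyI mono_lifted_cdf lifted_cdf_degree_one lifted_cdf_zero)
qed

end

context irrational_lift
begin

text \<open>Realise the semiconjugacy \<open>h\<close> as a distribution function. By
  \<open>lifted_cdf_distr\<close> and surjectivity of \<Phi>, the push-forward has distribution
  function \<open>h\<close> plus a constant, which the normalisation at 0 annihilates; hence the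
  measure is invariant.\<close>

lemma invariant_prob_exists: "\<exists>\<mu>. invariant_prob \<Phi> \<mu>"
proof -
  obtain h where h: "rotation_conjugacy \<Phi> h" using rotation_conjugacy_exists by blast
  note cont = rotation_conjugacy_continuous[OF h]
  obtain \<mu> where \<mu>: "circle_prob \<mu>" "lifted_cdf \<mu> = h"
    using circle_prob_exists[of h] h cont by (auto simp: rotation_conjugacy_def)
  let ?\<mu>' = "distr \<mu> \<mu> (phase_map \<Phi>)"
  have \<mu>': "circle_prob ?\<mu>'" by (rule circle_prob_distr[OF \<mu>(1)])
  obtain c where c: "\<And>y. lifted_cdf ?\<mu>' (\<Phi> y) = h y + c"
    using lifted_cdf_distr[OF \<mu>(1)] \<mu>(2) by auto
  have eq: "lifted_cdf ?\<mu>' x = h x + (c - \<rho>)" for x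
  proof -
    obtain y where "x = \<Phi> y" using surj_lift by (metis surjD)
    then show ?thesis using c[of y] h by (simp add: rotation_conjugacy_def)
  qed
  moreover have "lifted_cdf ?\<mu>' 0 = 0" "h 0 = 0"
    using circle_prob.lifted_cdf_zero[OF \<mu>'] h by (auto simp: rotation_conjugacy_def)
  ultimately have "lifted_cdf ?\<mu>' = h" by (metis add.right_neutral add_0 ext)
  then have "?\<mu>' = \<mu>"
    using \<mu> cont by (intro circle_prob_eqI[OF \<mu>' \<mu>(1)]) auto
  then show ?thesis using \<mu>(1) invariant_prob_iff by blast
qed

lemma invariant_prob_unique:
  assumes "invariant_prob \<Phi> \<mu>" "invariant_prob \<Phi> \<mu>'"
  shows "\<mu> = \<mu>'"
proof (rule circle_prob_eqI)
  show "circle_prob \<mu>" "circle_prob \<mu>'" using assms by (auto simp: invariant_prob_iff)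
  note conj = assms[THEN rotation_conjugacy_lifted_cdf]
  show "lifted_cdf \<mu> = lifted_cdf \<mu>'" using conj by (rule rotation_conjugacy_unique)
  show "isCont (lifted_cdf \<mu>) x" for x using conj(1) by (rule rotation_conjugacy_continuous)
qed

lemma invariant_measure: "invariant_prob \<Phi> (invariant_measure \<Phi>)"
  unfolding invariant_measure_def
  by (rule theI') (use invariant_prob_exists invariant_prob_unique in blast)

lemma circle_prob_invariant_measure: "circle_prob (invariant_measure \<Phi>)"
  using invariant_measure invariant_prob_iff by blast

lemma cdf_invariant_measure:
  assumes "rotation_conjugacy \<Phi> h"
  shows "cdf (distr (invariant_measure \<Phi>) borel (\<lambda>t. t)) x = h (max 0 (min 1 x))"
proof -
  have "lifted_cdf (invariant_measure \<Phi>) = h"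
    by (intro rotation_conjugacy_unique rotation_conjugacy_lifted_cdf invariant_measure assms)
  then show ?thesis
    using circle_prob.cdf_circle[OF circle_prob_invariant_measure] rotation_conjugacy_continuous[OF assms]
    by simp
qed

text \<open>Permits computing with any random variable \<open>Y\<close> distributed according to the
  invariant measure, such as those supplied by Skorohod's theorem.\<close>

lemma integral_isi_distribution:
  assumes Y: "Y \<in> borel_measurable M" "distr M borel Y = distr (invariant_measure \<Phi>) borel (\<lambda>t. t)"
    and g: "g \<in> borel_measurable borel"
  shows "(LINT x|isi_distribution \<Phi>. g x) = (LINT \<omega>|M. g (\<Phi> (Y \<omega>) - Y \<omega>) :: real)"
proof -
  interpret circle_prob "invariant_measure \<Phi>" by (rule circle_prob_invariant_measure)
  have disp: "(\<lambda>t. \<Phi> t - t) \<in> borel_measurable borel"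
    using borel_measurable_lift by measurable
  then have gdisp: "(\<lambda>t. g (\<Phi> t - t)) \<in> borel_measurable borel"
    using g by measurable
  have "(LINT x|isi_distribution \<Phi>. g x) = (LINT t|invariant_measure \<Phi>. g (\<Phi> t - t))"
    unfolding isi_distribution_def by (rule integral_distr[OF borel_measurable_circle[OF disp] g])
  also have "\<dots> = (LINT t|distr (invariant_measure \<Phi>) borel (\<lambda>t. t). g (\<Phi> t - t))"
    by (rule integral_distr[symmetric, OF borel_measurable_circle gdisp]) simp
  also have "\<dots> = (LINT \<omega>|M. g (\<Phi> (Y \<omega>) - Y \<omega>))"
    unfolding Y(2)[symmetric] by (rule integral_distr[OF Y(1) gdisp])
  finally show ?thesis .
qed

end

text \<open>The invariant measure and the displacement both vary with \<open>n\<close>, so weak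
  convergence of the measures alone does not suffice. On a Skorohod coupling the integrands
  themselves converge pointwise.\<close>

theorem isi_distribution_converges_weakly:
  assumes "irrational_lift \<Phi>" and irr: "\<And>n. irrational_lift (\<Phi>s n)"
    and lim: "\<And>t. (\<lambda>n. \<Phi>s n t) \<longlonglongrightarrow> \<Phi> t"
  shows "converges_weakly (\<lambda>n. isi_distribution (\<Phi>s n)) (isi_distribution \<Phi>)"
  unfolding converges_weakly_def
proof (intro allI impI, elim conjE)
  fix g :: "real \<Rightarrow> real" assume g: "continuous_on UNIV g" "bounded (range g)"
  interpret irrational_lift \<Phi> by fact
  interpret s: irrational_lift "\<Phi>s n" for n by (rule irr)
  let ?\<nu> = "distr (invariant_measure \<Phi>) borel (\<lambda>t. t)"
  let ?\<nu>s = "\<lambda>n. distr (invariant_measure (\<Phi>s n)) borel (\<lambda>t. t)"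
  obtain h where h: "rotation_conjugacy \<Phi> h" using rotation_conjugacy_exists by blast
  obtain hs where hs: "\<And>n. rotation_conjugacy (\<Phi>s n) (hs n)"
    using s.rotation_conjugacy_exists by metis
  have real: "real_distribution (?\<nu>s n)" "real_distribution ?\<nu>" for n
    by (intro circle_prob.real_distribution_circle circle_prob_invariant_measure
        s.circle_prob_invariant_measure)+
  have "weak_conv_m ?\<nu>s ?\<nu>"
    unfolding weak_conv_m_def weak_conv_def
    using rotation_conjugacy_tendsto[OF assms h hs]
    by (simp add: cdf_invariant_measure[OF h] s.cdf_invariant_measure[OF hs])
  from Skorohod[OF real this] obtain \<Omega> :: "real measure" and Ys Y where \<Omega>: "prob_space \<Omega>"
    and Ys: "\<forall>n. Ys n \<in> borel_measurable \<Omega>" "\<forall>n. distr \<Omega> borel (Ys n) = ?\<nu>s n"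
    and Y: "Y \<in> measurable \<Omega> lborel" "distr \<Omega> borel Y = ?\<nu>"
    and YsY: "\<forall>\<omega>\<in>space \<Omega>. (\<lambda>n. Ys n \<omega>) \<longlonglongrightarrow> Y \<omega>"
    by blast
  note Ys = Ys[rule_format] and Y = Y[simplified] and YsY = YsY[rule_format]
  interpret \<Omega>: prob_space \<Omega> by fact
  have gm: "g \<in> borel_measurable borel" by (rule borel_measurable_continuous_onI) (rule g)
  obtain B where B: "\<And>x. norm (g x) \<le> B" using g(2) by (auto simp: bounded_iff)
  have "(\<lambda>n. LINT \<omega>|\<Omega>. g (\<Phi>s n (Ys n \<omega>) - Ys n \<omega>)) \<longlonglongrightarrow> (LINT \<omega>|\<Omega>. g (\<Phi> (Y \<omega>) - Y \<omega>))"
  proof (rule integral_dominated_convergence[where w = "\<lambda>_. B"])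
    show "(\<lambda>\<omega>. g (\<Phi> (Y \<omega>) - Y \<omega>)) \<in> borel_measurable \<Omega>"
      using gm Y(1) borel_measurable_lift by measurable
    show "(\<lambda>\<omega>. g (\<Phi>s n (Ys n \<omega>) - Ys n \<omega>)) \<in> borel_measurable \<Omega>" for n
      by (rule measurable_compose[OF borel_measurable_diff gm])
        (rule measurable_compose[OF Ys(1) s.borel_measurable_lift] Ys(1))+
    show "AE \<omega> in \<Omega>. (\<lambda>n. g (\<Phi>s n (Ys n \<omega>) - Ys n \<omega>)) \<longlonglongrightarrow> g (\<Phi> (Y \<omega>) - Y \<omega>)"
    proof (rule AE_I2)
      fix \<omega> assume "\<omega> \<in> space \<Omega>"
      \<comment> \<open>Map and argument vary together here, which is exactly the situation of
        \<open>mono_tendsto_continuous_convergence\<close>.\<close>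
      have "(\<lambda>n. \<Phi>s n (Ys n \<omega>)) \<longlonglongrightarrow> \<Phi> (Y \<omega>)"
        by (rule mono_tendsto_continuous_convergence[OF s.mono_lift lim _ YsY[OF \<open>\<omega> \<in> space \<Omega>\<close>]])
          (use cont in \<open>simp add: continuous_on_eq_continuous_at\<close>)
      then have "(\<lambda>n. \<Phi>s n (Ys n \<omega>) - Ys n \<omega>) \<longlonglongrightarrow> \<Phi> (Y \<omega>) - Y \<omega>"
        by (intro tendsto_diff YsY \<open>\<omega> \<in> space \<Omega>\<close>)
      moreover have "isCont g (\<Phi> (Y \<omega>) - Y \<omega>)"
        using g(1) by (simp add: continuous_on_eq_continuous_at)
      ultimately show "(\<lambda>n. g (\<Phi>s n (Ys n \<omega>) - Ys n \<omega>)) \<longlonglongrightarrow> g (\<Phi> (Y \<omega>) - Y \<omega>)"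
        by (intro isCont_tendsto_compose[of _ g])
    qed
  qed (use B in auto)
  then show "(\<lambda>n. LINT x|isi_distribution (\<Phi>s n). g x) \<longlonglongrightarrow> (LINT x|isi_distribution \<Phi>. g x)"
    by (simp add: integral_isi_distribution[OF Y gm] s.integral_isi_distribution[OF Ys gm])
qed

section \<open>Firing maps\<close>

lemma Linf_seminorm_AE_le:
  assumes "Linf_seminorm k g \<le> ennreal B" "B \<ge> 0"
  shows "AE u in lebesgue. u \<in> {- real k..real k} \<longrightarrow> \<bar>g u\<bar> \<le> B"
proof -
  have "AE u in restrict_space lebesgue {- real k..real k}. ennreal \<bar>g u\<bar> \<le> Linf_seminorm k g"
    unfolding Linf_seminorm_def by (rule esssup_AE)
  then have "AE u in restrict_space lebesgue {- real k..real k}. \<bar>g u\<bar> \<le> B"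
    by eventually_elim (use assms in \<open>metis ennreal_le_iff order_trans\<close>)
  then show ?thesis by (subst (asm) AE_restrict_space_iff) auto
qed

lemma Linf_loc_AE_bounded:
  assumes "f \<in> Linf_loc"
  obtains B where "B \<ge> 0" "AE u in lebesgue. u \<in> {- real k..real k} \<longrightarrow> \<bar>f u\<bar> \<le> B"
proof -
  have "Linf_seminorm k f < \<infinity>" using assms by (simp add: Linf_loc_def)
  then obtain B where "Linf_seminorm k f = ennreal B" "B \<ge> 0"
    by (cases "Linf_seminorm k f") auto
  then show thesis using that Linf_seminorm_AE_le[of k f B] by simp
qed

lemma Icc_subset_symmetric_interval: "\<exists>k. {a..b::real} \<subseteq> {- real k..real k}"
proof -
  obtain k where "max \<bar>a\<bar> \<bar>b\<bar> \<le> real k" using real_arch_simple by blast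
  then show ?thesis by (intro exI[of _ k]) auto
qed

section \<open>A single firing map as a lift\<close>

locale firing_system =
  fixes \<sigma> :: real and f :: "real \<Rightarrow> real"
  assumes \<sigma>: "\<sigma> \<ge> 0" and Linf: "f \<in> Linf_loc" and periodic: "ae_periodic1 f"
    and pos: "AE t in lebesgue. f t - \<sigma> > 0"
begin

definition w :: "real \<Rightarrow> real" where "w u = (f u - \<sigma>) * exp (\<sigma> * u)"

text \<open>A Henstock-Kurzweil integral, for which additivity, shift and continuity in the
  endpoints are at hand; \<open>J_lebesgue\<close> identifies it with the integral in
  \<open>firing_map\<close>.\<close>

definition J :: "real \<Rightarrow> real \<Rightarrow> real" where "J t s = integral {t..s} w"

lemma w_measurable: "w \<in> borel_measurable lebesgue"
proof -
  have "(\<lambda>u. exp (\<sigma> * u)) \<in> borel_measurable lebesgue"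
    by (intro measurable_completion) measurable
  moreover have "f \<in> borel_measurable lebesgue" using Linf by (simp add: Linf_loc_def)
  ultimately show ?thesis unfolding w_def by measurable
qed

lemma w_set_integrable: "set_integrable lebesgue {a..b} w"
proof -
  obtain k where k: "{a..b} \<subseteq> {- real k..real k}" using Icc_subset_symmetric_interval by blast
  obtain B where "B \<ge> 0" and B: "AE u in lebesgue. u \<in> {- real k..real k} \<longrightarrow> \<bar>f u\<bar> \<le> B"
    using Linf_loc_AE_bounded[OF Linf] .
  show ?thesis
    unfolding set_integrable_def
  proof (rule integrableI_bounded_set[where A = "{a..b}" and B = "(B + \<sigma>) * exp (\<sigma> * real k)"])
    show "(\<lambda>x. indicator {a..b} x *\<^sub>R w x) \<in> borel_measurable lebesgue"
      by (intro borel_measurable_scaleR borel_measurable_indicator w_measurable) auto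
    show "AE x in lebesgue. x \<in> {a..b} \<longrightarrow>
        norm (indicator {a..b} x *\<^sub>R w x) \<le> (B + \<sigma>) * exp (\<sigma> * real k)"
      using B
    proof eventually_elim
      case (elim x)
      show ?case
      proof
        assume x: "x \<in> {a..b}"
        then have "\<bar>f x\<bar> \<le> B" "x \<le> real k" using elim k by auto
        then have "\<bar>f x - \<sigma>\<bar> * exp (\<sigma> * x) \<le> (B + \<sigma>) * exp (\<sigma> * real k)"
          using \<sigma> by (intro mult_mono) (auto simp: mult_left_mono)
        then show "norm (indicator {a..b} x *\<^sub>R w x) \<le> (B + \<sigma>) * exp (\<sigma> * real k)"
          using x by (simp add: w_def abs_mult)
      qed
    qed
  qed (auto simp: emeasure_lborel_Icc_eq)
qed

lemma w_integrable: "w integrable_on {a..b}"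
  by (rule set_lebesgue_integral_eq_integral(1)[OF w_set_integrable])

lemma J_lebesgue: "J t s = (LINT u:{t..s}|lebesgue. w u)"
  unfolding J_def by (rule set_lebesgue_integral_eq_integral(2)[OF w_set_integrable, symmetric])

lemma J_add: "t \<le> r \<Longrightarrow> r \<le> s \<Longrightarrow> J t r + J r s = J t s"
  unfolding J_def
  by (rule Henstock_Kurzweil_Integration.integral_combine[OF _ _ w_integrable])

lemma J_trivial: "s \<le> t \<Longrightarrow> J t s = 0"
  unfolding J_def by (cases "s = t") auto

text \<open>A nonnegative integrand with vanishing integral is zero almost everywhere; as
  \<open>w\<close> is positive almost everywhere, the interval would be a null set.\<close>

lemma J_pos:
  assumes "t < s"
  shows "0 < J t s"
proof -
  let ?g = "\<lambda>u. indicator {t..s} u *\<^sub>R w u"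
  have int: "integrable lebesgue ?g" using w_set_integrable[of t s] by (simp add: set_integrable_def)
  have wpos: "AE u in lebesgue. w u > 0" using pos by eventually_elim (simp add: w_def)
  then have nonneg: "AE u in lebesgue. 0 \<le> ?g u"
    by eventually_elim (simp add: indicator_def)
  have J: "J t s = (LINT u|lebesgue. ?g u)"
    by (simp add: J_lebesgue set_lebesgue_integral_def)
  have "J t s \<noteq> 0"
  proof
    assume "J t s = 0"
    then have "AE u in lebesgue. ?g u = 0"
      using integral_nonneg_eq_0_iff_AE[OF int nonneg] J by simp
    with wpos have "AE u in lebesgue. u \<notin> {t..s}"
      by eventually_elim (auto simp: indicator_def split: if_splits)
    then have "emeasure lebesgue {t..s} = 0"
      by (subst (asm) AE_iff_measurable[where N = "{t..s}"]) auto
    then show False using assms by simp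
  qed
  moreover have "0 \<le> J t s" unfolding J by (rule integral_nonneg_AE[OF nonneg])
  ultimately show ?thesis by simp
qed

lemma J_strict_mono: "t \<le> r \<Longrightarrow> r < s \<Longrightarrow> J t r < J t s"
  using J_add[of t r s] J_pos[of r s] by simp

text \<open>Translating by one period leaves \<open>f\<close> unchanged off a null set and
  multiplies the exponential weight by \<open>exp \<sigma>\<close>.\<close>

lemma J_shift: "J (t + 1) (s + 1) = exp \<sigma> * J t s"
proof -
  obtain N where N: "\<And>u. u \<in> space lebesgue - N \<Longrightarrow> f (u + 1) = f u" "N \<in> null_sets lebesgue"
    using periodic unfolding ae_periodic1_def by (rule AE_E3) (rule that)
  have "J (t + 1) (s + 1) = integral {t..s} (\<lambda>u. w (u + 1))"
    unfolding J_def using integral_shift_real_ivl[of "t + 1" 1 "s + 1" w] by simp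
  also have "\<dots> = integral {t..s} (\<lambda>u. exp \<sigma> * w u)"
  proof (rule integral_spike)
    show "negligible N" using N(2) by (simp add: negligible_iff_null_sets)
    fix u assume "u \<in> {t..s} - N"
    then have "f (u + 1) = f u" using N(1) by auto
    then show "exp \<sigma> * w u = w (u + 1)" by (simp add: w_def exp_add distrib_left)
  qed
  finally show ?thesis by (simp add: J_def)
qed

text \<open>Successive unit intervals contribute non-decreasing positive amounts, since
  \<open>J_shift\<close> multiplies by \<open>exp \<sigma> \<ge> 1\<close>; hence at least linear
  growth.\<close>

lemma J_unbounded: "\<exists>s\<ge>t. c \<le> J t s"
proof -
  have grow: "real k * J t (t + 1) \<le> J t (t + real k)" for k
  proof (induction k)
    case (Suc k)
    have "J t (t + 1) \<le> J (t + real k) (t + real k + 1)"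
    proof (induction k)
      case (Suc k)
      have "J (t + real k) (t + real k + 1) \<le> exp \<sigma> * J (t + real k) (t + real k + 1)"
        using \<sigma> J_pos[of "t + real k" "t + real k + 1"] by (simp add: mult_le_cancel_right1)
      also have "\<dots> = J (t + real (Suc k)) (t + real (Suc k) + 1)"
        unfolding J_shift[symmetric] by (simp add: add_ac)
      finally show ?case using Suc by simp
    qed simp
    then show ?case
      using Suc J_add[of t "t + real k" "t + real k + 1"] by (simp add: algebra_simps)
  qed (simp add: J_trivial)
  have "0 < J t (t + 1)" by (rule J_pos) simp
  then obtain k where "c < real k * J t (t + 1)" using ex_less_of_nat_mult by blast
  then show ?thesis using grow[of k] by (intro exI[of _ "t + real k"]) auto
qed

lemma J_continuous_right: "continuous_on {t..s} (J t)"
  unfolding J_def by (rule indefinite_integral_continuous_1[OF w_integrable])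

lemma J_continuous_left: "continuous_on {t..s} (\<lambda>x. J x s)"
  unfolding J_def by (rule indefinite_integral_continuous_1'[OF w_integrable])

abbreviation \<Phi> :: "real \<Rightarrow> real" where "\<Phi> \<equiv> firing_map \<sigma> f"

text \<open>The intermediate value theorem yields \<open>s\<close> with \<open>J t s\<close> equal
  to the threshold. By strict monotonicity the set in the definition is exactly
  \<open>{s..}\<close>, so the infimum is attained.\<close>

lemma firing_map_properties: "t < \<Phi> t" "J t (\<Phi> t) = exp (\<sigma> * t)"
proof -
  obtain s0 where s0: "s0 \<ge> t" "exp (\<sigma> * t) \<le> J t s0" using J_unbounded by blast
  then obtain s where s: "t \<le> s" "J t s = exp (\<sigma> * t)"
    using IVT'[of "J t" t "exp (\<sigma> * t)" s0] J_continuous_right[of t s0] by (auto simp: J_trivial)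
  have "s \<noteq> t" using s(2) J_trivial[of t t] by auto
  then have "t < s" using s(1) by simp
  have "{r. r > t \<and> exp (\<sigma> * t) \<le> J t r} = {s..}"
  proof (intro set_eqI iffI)
    fix r assume "r \<in> {r. r > t \<and> exp (\<sigma> * t) \<le> J t r}"
    then show "r \<in> {s..}" using J_strict_mono[of t r s] s(2) by fastforce
  next
    fix r assume "r \<in> {s..}"
    then show "r \<in> {r. r > t \<and> exp (\<sigma> * t) \<le> J t r}"
      using J_strict_mono[of t s r] s \<open>t < s\<close> by (cases "r = s") auto
  qed
  then have "\<Phi> t = s"
    by (simp add: firing_map_def J_lebesgue w_def)
  then show "t < \<Phi> t" "J t (\<Phi> t) = exp (\<sigma> * t)" using s \<open>t < s\<close> by auto
qed

text \<open>Trades the infimum for an inequality on \<open>J\<close>. It holds for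
  \<open>s \<le> t\<close> too: there \<open>J t s = 0\<close> lies below the positive
  threshold.\<close>

lemma firing_map_le_iff: "\<Phi> t \<le> s \<longleftrightarrow> exp (\<sigma> * t) \<le> J t s"
proof (cases "s \<le> t")
  case True
  then show ?thesis using firing_map_properties(1)[of t] by (simp add: J_trivial not_le)
next
  case False
  then show ?thesis
    using J_strict_mono[of t s "\<Phi> t"] J_strict_mono[of t "\<Phi> t" s] firing_map_properties[of t]
    by (cases s "\<Phi> t" rule: linorder_cases) auto
qed

lemma firing_map_less_iff: "\<Phi> t < s \<longleftrightarrow> exp (\<sigma> * t) < J t s"
proof (cases "s \<le> t")
  case True
  then show ?thesis using firing_map_properties(1)[of t] by (simp add: J_trivial not_less)
next
  case False
  then show ?thesis
    using J_strict_mono[of t s "\<Phi> t"] J_strict_mono[of t "\<Phi> t" s] firing_map_properties[of t]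
    by (cases s "\<Phi> t" rule: linorder_cases) auto
qed

lemma firing_map_strict_mono: "strict_mono \<Phi>"
proof (rule strict_monoI)
  fix t r :: real assume "t < r"
  note P = firing_map_properties[of r]
  have "exp (\<sigma> * t) \<le> exp (\<sigma> * r)" using \<sigma> \<open>t < r\<close> by (simp add: mult_left_mono)
  also have "\<dots> < J t (\<Phi> r)"
    using J_add[of t r "\<Phi> r"] J_pos[OF \<open>t < r\<close>] P \<open>t < r\<close> by simp
  finally show "\<Phi> t < \<Phi> r" by (simp add: firing_map_less_iff)
qed

text \<open>The factor \<open>exp \<sigma>\<close> from \<open>J_shift\<close> cancels against the
  same factor in the threshold at \<open>t + 1\<close>.\<close>

lemma firing_map_degree_one: "\<Phi> (t + 1) = \<Phi> t + 1"
proof -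
  have "\<Phi> (t + 1) \<le> s + 1 \<longleftrightarrow> \<Phi> t \<le> s" for s
    unfolding firing_map_le_iff J_shift by (simp add: distrib_left exp_add mult.commute)
  from this[of "\<Phi> (t + 1) - 1"] this[of "\<Phi> t"] show ?thesis by simp
qed

lemma firing_map_isCont: "isCont \<Phi> t"
proof -
  have J: "isCont (\<lambda>x. J x b) t" if "t < b" for b
    by (rule continuous_on_interior[OF J_continuous_left[of "t - 1" b]]) (use that in auto)
  have E: "isCont (\<lambda>x. exp (\<sigma> * x)) t" by (intro continuous_intros)
  show ?thesis
    unfolding isCont_def
  proof (rule order_tendstoI)
    fix a assume "a < \<Phi> t"
    \<comment> \<open>\<open>b\<close> leaves room above \<open>a\<close>, so a non-strict bound at
      \<open>b\<close> suffices; \<open>t < b\<close> makes \<open>t\<close> an interior point,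
      where \<open>J x b\<close> is continuous in \<open>x\<close>.\<close>
    then obtain b where b: "max a t < b" "b < \<Phi> t"
      using dense[of "max a t" "\<Phi> t"] firing_map_properties(1)[of t] by auto
    have "((\<lambda>x. exp (\<sigma> * x) - J x b) \<longlongrightarrow> exp (\<sigma> * t) - J t b) (at t)"
      using J[of b] E b unfolding isCont_def by (intro tendsto_diff) auto
    moreover have "0 < exp (\<sigma> * t) - J t b" using b(2) firing_map_le_iff[of t b] by simp
    ultimately have "\<forall>\<^sub>F x in at t. 0 < exp (\<sigma> * x) - J x b" by (rule order_tendstoD(1))
    then show "\<forall>\<^sub>F x in at t. a < \<Phi> x"
    proof eventually_elim
      case (elim x)
      then show ?case using firing_map_le_iff[of x b] b(1) by auto
    qed
  next
    fix a assume "\<Phi> t < a"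
    then have a: "exp (\<sigma> * t) < J t a" "t < a"
      using firing_map_properties(1)[of t] by (simp_all flip: firing_map_less_iff)
    have "((\<lambda>x. J x a - exp (\<sigma> * x)) \<longlongrightarrow> J t a - exp (\<sigma> * t)) (at t)"
      using J[of a] E a unfolding isCont_def by (intro tendsto_diff) auto
    moreover have "0 < J t a - exp (\<sigma> * t)" using a(1) by simp
    ultimately have "\<forall>\<^sub>F x in at t. 0 < J x a - exp (\<sigma> * x)" by (rule order_tendstoD(1))
    then show "\<forall>\<^sub>F x in at t. \<Phi> x < a"
      by eventually_elim (simp add: firing_map_less_iff)
  qed
qed

sublocale circle_lift \<Phi>
  by unfold_locales
    (auto simp: firing_map_strict_mono firing_map_degree_one firing_map_isCont continuous_on_eq_continuous_at)

end

section \<open>Convergence of the firing maps\<close>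

text \<open>On an interval inside [-k,k] the integrands differ by at most the \<open>k\<close>-th
  seminorm times \<open>exp (\<sigma> * k)\<close>, which bounds the weight because
  \<open>\<sigma> \<ge> 0\<close>.\<close>

lemma firing_integral_tendsto:
  assumes f: "firing_system \<sigma> f" and fs: "\<And>n. firing_system \<sigma> (fs n)"
    and lim: "tendsto_Linf_loc fs f"
  shows "(\<lambda>n. firing_system.J \<sigma> (fs n) t s) \<longlonglongrightarrow> firing_system.J \<sigma> f t s"
proof -
  interpret firing_system \<sigma> f by fact
  interpret s: firing_system \<sigma> "fs n" for n by (rule fs)
  obtain k where k: "{t..s} \<subseteq> {- real k..real k}" using Icc_subset_symmetric_interval by blast
  have bound: "\<bar>s.J n t s - J t s\<bar> \<le> e * exp (\<sigma> * real k) * measure lebesgue {t..s}"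
    if "Linf_seminorm k (\<lambda>t. fs n t - f t) \<le> ennreal e" "e \<ge> 0" for n e
  proof -
    let ?d = "\<lambda>u. indicator {t..s} u *\<^sub>R s.w n u - indicator {t..s} u *\<^sub>R w u"
    let ?C = "e * exp (\<sigma> * real k)"
    have int: "integrable lebesgue (\<lambda>u. indicator {t..s} u *\<^sub>R s.w n u)"
      "integrable lebesgue (\<lambda>u. indicator {t..s} u *\<^sub>R w u)"
      using w_set_integrable s.w_set_integrable by (auto simp: set_integrable_def)
    have J: "s.J n t s - J t s = (LINT u|lebesgue. ?d u)"
      unfolding J_lebesgue s.J_lebesgue set_lebesgue_integral_def
      by (rule Bochner_Integration.integral_diff[OF int, symmetric])
    have "\<bar>s.J n t s - J t s\<bar> \<le> (LINT u|lebesgue. norm (?d u))"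
      unfolding J real_norm_def[symmetric] by (rule integral_norm_bound)
    also have "\<dots> \<le> (LINT u|lebesgue. indicator {t..s} u *\<^sub>R ?C)"
    proof (rule integral_mono_AE)
      show "integrable lebesgue (\<lambda>u. norm (?d u))" using int by simp
      show "integrable lebesgue (\<lambda>u. indicator {t..s} u *\<^sub>R ?C)"
        by (intro integrable_scaleR_left integrable_real_indicator) (auto simp: emeasure_lborel_Icc_eq)
      show "AE u in lebesgue. norm (?d u) \<le> indicator {t..s} u *\<^sub>R ?C"
        using Linf_seminorm_AE_le[OF that]
      proof eventually_elim
        case (elim u)
        show ?case
        proof (cases "u \<in> {t..s}")
          case True
          then have "\<bar>fs n u - f u\<bar> \<le> e" "u \<le> real k" using elim k by auto
          then have "\<bar>fs n u - f u\<bar> * exp (\<sigma> * u) \<le> ?C"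
            using \<sigma> \<open>e \<ge> 0\<close> by (intro mult_mono) (auto simp: mult_left_mono)
          moreover have "s.w n u - w u = (fs n u - f u) * exp (\<sigma> * u)"
            by (simp add: w_def s.w_def algebra_simps)
          ultimately show ?thesis using True by (simp add: abs_mult)
        qed simp
      qed
    qed
    also have "\<dots> = ?C * measure lebesgue {t..s}" by simp
    finally show ?thesis .
  qed
  show ?thesis
  proof (rule tendstoI)
    fix e :: real assume "e > 0"
    \<comment> \<open>The summand 1 keeps \<open>c\<close> positive for an interval of measure zero
      and makes the final estimate strict.\<close>
    define c where "c = exp (\<sigma> * real k) * measure lebesgue {t..s} + 1"
    have "c > 0" by (simp add: c_def add_nonneg_pos)
    have "(\<lambda>n. Linf_seminorm k (\<lambda>t. fs n t - f t)) \<longlonglongrightarrow> 0"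
      using lim by (simp add: tendsto_Linf_loc_def)
    moreover have "0 < ennreal (e / c)" using \<open>e > 0\<close> \<open>c > 0\<close> by simp
    ultimately have "\<forall>\<^sub>F n in sequentially. Linf_seminorm k (\<lambda>t. fs n t - f t) < ennreal (e / c)"
      by (rule order_tendstoD(2))
    then show "\<forall>\<^sub>F n in sequentially. dist (s.J n t s) (J t s) < e"
    proof eventually_elim
      case (elim n)
      have "\<bar>s.J n t s - J t s\<bar> \<le> e / c * exp (\<sigma> * real k) * measure lebesgue {t..s}"
        using elim \<open>e > 0\<close> \<open>c > 0\<close> by (intro bound) auto
      also have "\<dots> = e / c * (c - 1)" by (simp add: c_def)
      also have "\<dots> < e" using \<open>e > 0\<close> \<open>c > 0\<close> by (simp add: field_simps)
      finally show ?case by (simp add: dist_real_def)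
    qed
  qed
qed

text \<open>Being above or below a level is a strict inequality between \<open>J\<close> and a
  threshold independent of \<open>n\<close>, so it persists for large \<open>n\<close>. For the
  lower bound an intermediate \<open>b\<close> provides strictness.\<close>

lemma firing_map_tendsto:
  assumes f: "firing_system \<sigma> f" and fs: "\<And>n. firing_system \<sigma> (fs n)"
    and lim: "tendsto_Linf_loc fs f"
  shows "(\<lambda>n. firing_map \<sigma> (fs n) t) \<longlonglongrightarrow> firing_map \<sigma> f t"
proof -
  interpret firing_system \<sigma> f by fact
  interpret s: firing_system \<sigma> "fs n" for n by (rule fs)
  note J = firing_integral_tendsto[OF assms]
  show ?thesis
  proof (rule order_tendstoI)
    fix a assume "a < \<Phi> t"
    then obtain b where b: "a < b" "b < \<Phi> t" using dense by blast
    have "J t b < exp (\<sigma> * t)" using b(2) firing_map_le_iff[of t b] by simp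
    from order_tendstoD(2)[OF J this] show "\<forall>\<^sub>F n in sequentially. a < s.\<Phi> n t"
    proof eventually_elim
      case (elim n)
      then show ?case using s.firing_map_le_iff[of n t b] b(1) by auto
    qed
  next
    fix a assume "\<Phi> t < a"
    then have "exp (\<sigma> * t) < J t a" by (simp add: firing_map_less_iff)
    from order_tendstoD(1)[OF J this] show "\<forall>\<^sub>F n in sequentially. s.\<Phi> n t < a"
      by eventually_elim (simp add: s.firing_map_less_iff)
  qed
qed

theorem proposition3p16:
  fixes \<sigma> \<delta> :: real and f :: "real \<Rightarrow> real" and fs :: "nat \<Rightarrow> real \<Rightarrow> real"
  assumes "\<sigma> \<ge> 0"
    and "f \<in> Linf_loc" and "\<And>n. fs n \<in> Linf_loc"
    and "ae_periodic1 f" and "\<And>n. ae_periodic1 (fs n)"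
    and "\<And>n. AE t in lebesgue. fs n t - \<sigma> > 0"
    and "\<delta> > 0" and "AE t in lebesgue. f t - \<sigma> > \<delta>"
    and "rotation_number (firing_map \<sigma> f) \<notin> \<rat>"
    and "\<And>n. rotation_number (firing_map \<sigma> (fs n)) \<notin> \<rat>"
    and "tendsto_Linf_loc fs f"
  shows "converges_weakly (\<lambda>n. isi_distribution (firing_map \<sigma> (fs n)))
           (isi_distribution (firing_map \<sigma> f))"
proof -
  have "AE t in lebesgue. f t - \<sigma> > 0"
    using assms(8) by eventually_elim (use \<open>\<delta> > 0\<close> in simp)
  then have f: "firing_system \<sigma> f" using assms by unfold_locales
  have fs: "firing_system \<sigma> (fs n)" for n using assms by unfold_locales
  interpret firing_system \<sigma> f by (rule f)
  interpret s: firing_system \<sigma> "fs n" for n by (rule fs)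
  show ?thesis
  proof (rule isi_distribution_converges_weakly)
    show "irrational_lift \<Phi>" "irrational_lift (s.\<Phi> n)" for n
      using assms(9,10) by unfold_locales
    show "(\<lambda>n. s.\<Phi> n t) \<longlonglongrightarrow> \<Phi> t" for t
      using f fs assms(11) by (rule firing_map_tendsto)
  qed
qed

end
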